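(* There exists a function $g:\mathbb{N}\to\mathbb{R}$ with $g(k)/k \to 0$ as $k\to\infty$ such that for all integers $k,\ell \geq 2$ with $\ell \leq k/4$, \[ r(k,\ell) \leq 2^{-\frac{2}{9}\ell + g(k)} \binom{k+\ell}{\ell}. \]
   Context: For integers $k,\ell\geq 2$, the off-diagonal Ramsey number $r(k,\ell)$ is the least integer $N$ such that every two-coloring of the edges of the complete graph $K_N$ with colors red and blue contains a red $K_k$ or a blue $K_\ell$. *)

theory Defs
  imports Complex_Main "HOL-Library.Ramsey"
begin

text \<open>The vertex set of the complete graph on \<open>N\<close> vertices is \<open>{..<N}\<close> and its edges are the
  2-element subsets. In \<open>partn_lst {..<N} [k, l] 2\<close> colour 0 is red and colour 1 is blue: every
  such edge colouring has a red clique on \<open>k\<close> vertices or a blue one on \<open>l\<close> vertices.\<close>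

definition ramsey_number :: "nat \<Rightarrow> nat \<Rightarrow> nat" where
  "ramsey_number k l = (LEAST N. partn_lst {..<N} [k, l] 2)"

text \<open>The least element exists by Ramsey's theorem, so \<open>LEAST\<close> is not an arbitrary value here.\<close>

lemma ramsey_number_le_iff:
  "ramsey_number k l \<le> N \<longleftrightarrow> partn_lst {..<N} [k, l] 2"
proof
  have "partn_lst {..<ramsey_number k l} [k, l] 2"
    unfolding ramsey_number_def by (rule LeastI) (rule ramsey2_full)
  then show "partn_lst {..<N} [k, l] 2" if "ramsey_number k l \<le> N"
    using that partn_lst_greater_resource by blast
next
  show "ramsey_number k l \<le> N" if "partn_lst {..<N} [k, l] 2"
    unfolding ramsey_number_def using that by (rule Least_le)
qed

lemma partn_lst_two_colours:
  fixes N :: nat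
  shows "partn_lst {..<N} [k, l] 2 \<longleftrightarrow>
    (\<forall>f :: nat set \<Rightarrow> nat. (\<forall>e \<in> [{..<N}]\<^bsup>2\<^esup>. f e = 0 \<or> f e = 1) \<longrightarrow>
      (\<exists>R \<subseteq> {..<N}. card R = k \<and> (\<forall>e \<in> [R]\<^bsup>2\<^esup>. f e = 0)) \<or>
      (\<exists>B \<subseteq> {..<N}. card B = l \<and> (\<forall>e \<in> [B]\<^bsup>2\<^esup>. f e = 1)))"
proof -
  have set_eq: "{..<length [k, l]} = {0, 1::nat}" by auto
  have ex_eq: "(\<exists>i < length [k, l]. P i) \<longleftrightarrow> P 0 \<or> P 1" for P
    by (auto simp: less_Suc_eq)
  have fin: "finite A" if "A \<subseteq> {..<N}" for A
    using that finite_subset by blast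
  have mono: "monochromatic {..<N} m 2 f i \<longleftrightarrow>
      (\<exists>H \<subseteq> {..<N}. card H = m \<and> (\<forall>e \<in> [H]\<^bsup>2\<^esup>. f e = i))" for m i and f :: "nat set \<Rightarrow> nat"
    unfolding monochromatic_def nsets_def[of "{..<N}" m] image_subset_iff Bex_def mem_Collect_eq
      singleton_iff
    using fin by metis
  show ?thesis
    unfolding partn_lst_def set_eq ex_eq mono
      by (simp add: Pi_iff Ball_def[of "_ \<rightarrow> _"] del: One_nat_def)
qed

end

theory Submission
  imports Defs "HOL-Analysis.Analysis"
begin

text \<open>
  For vertex sets \<open>X\<close>, \<open>Y\<close> let \<open>f w\<close> be the positive part of (red density from \<open>w\<close> to \<open>Y\<close>) \<open>- p\<close>, and
  consider the potential \<open>\<Psi>(X, Y) = (\<Sum>w\<in>X. f w ^ c)\<close> for a large constant \<open>c\<close>. Either some \<open>v \<in> X\<close> has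
  a blue neighbourhood carrying a fraction \<open>\<mu>\<close> of the potential, so that \<open>v\<close> can be moved to a blue
  clique without touching \<open>Y\<close>; or all blue neighbourhoods are light, and then Cauchy--Schwarz for red
  codegrees into \<open>Y\<close>, with weights \<open>f ^ (c - 1)\<close>, provides a \<open>v\<close> such that after replacing \<open>Y\<close> by the red
  neighbourhood of \<open>v\<close> the potential is large on the red or on the blue neighbourhood of \<open>v\<close> in \<open>X\<close>.
  A red step multiplies \<open>\<Psi>(X, Y) * card Y\<close> by about \<open>x = (1 - \<mu>) * p powr (1 / (1 - \<mu>))\<close> and a blue step
  by \<open>\<mu>\<close>. Once the potential is bounded, the Erdos--Szekeres bound in \<open>Y\<close> finishes, so
  \<open>\<Psi>(X, Y) * card Y \<ge> C * x ^ (-k) * (\<mu> * (1 - x)) ^ (-l)\<close> suffices.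

  This is applied with \<open>X = Y\<close> the whole vertex set and \<open>\<mu> = l / (k + l)\<close>. By induction on \<open>l\<close> the blue
  degrees have density at most \<open>2 powr (2/9) * \<mu> < 7/6 * \<mu>\<close>, the ratio of consecutive bounds, so
  \<open>p = 1 - 7/6 * \<mu>\<close> is admissible. What remains is an inequality in the single variable \<open>\<mu> \<le> 1/5\<close>, which
  concavity reduces to its endpoint \<open>\<mu> = 1/5\<close>, that is \<open>l = k / 4\<close>; there it is almost an equality.
\<close>

section \<open>Book steps\<close>

text \<open>One relation serves both colours: blue cliques are cliques of the negated relation, and
  \<open>u \<noteq> v\<close> keeps the diagonal out of the condition.\<close>

definition has_clique :: "('a \<Rightarrow> 'a \<Rightarrow> bool) \<Rightarrow> 'a set \<Rightarrow> nat \<Rightarrow> bool" where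
  "has_clique E A k \<longleftrightarrow> (\<exists>S\<subseteq>A. finite S \<and> card S = k \<and> (\<forall>u\<in>S. \<forall>v\<in>S. u \<noteq> v \<longrightarrow> E u v))"

lemma has_clique_0 [simp]: "has_clique E A 0"
  unfolding has_clique_def by (rule exI[of _ "{}"]) auto

lemma has_clique_mono: "has_clique E A k \<Longrightarrow> A \<subseteq> B \<Longrightarrow> has_clique E B k"
  unfolding has_clique_def by blast

lemma has_clique_Suc:
  assumes "has_clique E A k" "v \<notin> A" "\<And>w. w \<in> A \<Longrightarrow> E v w \<and> E w v"
  shows "has_clique E (insert v A) (Suc k)"
proof -
  obtain S where S: "S \<subseteq> A" "finite S" "card S = k" "\<forall>u\<in>S. \<forall>v\<in>S. u \<noteq> v \<longrightarrow> E u v"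
    using assms(1) unfolding has_clique_def by blast
  have "v \<notin> S" using S(1) assms(2) by blast
  then have "insert v S \<subseteq> insert v A" "finite (insert v S)" "card (insert v S) = Suc k"
    "\<forall>u\<in>insert v S. \<forall>w\<in>insert v S. u \<noteq> w \<longrightarrow> E u w"
    using S assms(3) by auto
  then show ?thesis unfolding has_clique_def by blast
qed

text \<open>A Young inequality, obtained from Bernoulli at \<open>z = e / (s * f)\<close> and tight
  for \<open>e = s * f\<close>. The free scale \<open>s\<close> later takes different values on red
  and on blue neighbours.\<close>

lemma pos_exponent_times_le_power_sum:
  fixes e f s :: real
  assumes "e \<ge> 0" "f \<ge> 0" "s > 0"
  shows "real (Suc m) * (e * f ^ m) \<le> e ^ Suc m / s ^ m + real m * s * f ^ Suc m"
proof (cases "f = 0")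
  case True
  then show ?thesis using assms by (cases m) auto
next
  case False
  then have f: "f > 0" using assms by simp
  define z where "z = e / (s * f)"
  have "z \<ge> 0" using assms f by (simp add: z_def)
  have ez: "e = z * (s * f)" using assms f by (simp add: z_def)
  have "1 + real (Suc m) * (z - 1) \<le> (1 + (z - 1)) ^ Suc m"
    by (rule Bernoulli_inequality) (use \<open>z \<ge> 0\<close> in simp)
  then have "real (Suc m) * z \<le> z ^ Suc m + real m" by (simp add: algebra_simps)
  then have "real (Suc m) * z * (s * f ^ Suc m) \<le> (z ^ Suc m + real m) * (s * f ^ Suc m)"
    using assms f by (intro mult_right_mono) auto
  moreover have "e ^ Suc m / s ^ m = z ^ Suc m * (s * f ^ Suc m)"
    unfolding ez using assms by (simp add: power_mult_distrib field_simps)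
  moreover have "e * f ^ m = z * (s * f ^ Suc m)" unfolding ez by simp
  ultimately show ?thesis by (metis (no_types, lifting) distrib_right mult.assoc)
qed

section \<open>Neighbourhoods in the two colours and the Erdos--Szekeres bound\<close>

locale red_graph =
  fixes E :: "'a \<Rightarrow> 'a \<Rightarrow> bool"
  assumes sym: "E u v \<Longrightarrow> E v u" and irrefl: "\<not> E v v"
begin

definition red :: "'a set \<Rightarrow> 'a \<Rightarrow> 'a set" where "red A v = {w \<in> A. E v w}"

definition blue :: "'a set \<Rightarrow> 'a \<Rightarrow> 'a set" where "blue A v = {w \<in> A. w \<noteq> v \<and> \<not> E v w}"

abbreviation "red_clique A k \<equiv> has_clique E A k"
abbreviation "blue_clique A k \<equiv> has_clique (\<lambda>u v. \<not> E u v) A k"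

lemma red_subset: "red A v \<subseteq> A" and blue_subset: "blue A v \<subseteq> A"
  by (auto simp: red_def blue_def)

lemma finite_red [simp]: "finite A \<Longrightarrow> finite (red A v)"
  and finite_blue [simp]: "finite A \<Longrightarrow> finite (blue A v)"
  by (auto simp: red_def blue_def)

lemma split_at:
  assumes "v \<in> A"
  shows "A = insert v (red A v \<union> blue A v)" "v \<notin> red A v" "v \<notin> blue A v"
    "red A v \<inter> blue A v = {}"
  using assms irrefl by (auto simp: red_def blue_def)

lemma sum_split_at:
  assumes "finite A" "v \<in> A"
  shows "sum g A = g v + sum g (red A v) + sum g (blue A v)"
proof -
  have "sum g A = sum g (insert v (red A v \<union> blue A v))" using split_at(1)[OF assms(2)] by simp
  also have "\<dots> = g v + sum g (red A v \<union> blue A v)"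
    using split_at[OF assms(2)] assms(1) by (intro sum.insert) auto
  also have "sum g (red A v \<union> blue A v) = sum g (red A v) + sum g (blue A v)"
    using split_at[OF assms(2)] assms(1) by (intro sum.union_disjoint) auto
  finally show ?thesis by (simp add: add.assoc)
qed

lemma red_clique_extend:
  assumes "red_clique (red A v) k" "v \<in> B" "A \<subseteq> B"
  shows "red_clique B (Suc k)"
  by (rule has_clique_mono[OF has_clique_Suc[OF assms(1)]])
     (use assms sym irrefl in \<open>auto simp: red_def\<close>)

lemma blue_clique_extend:
  assumes "blue_clique (blue A v) k" "v \<in> B" "A \<subseteq> B"
  shows "blue_clique B (Suc k)"
  by (rule has_clique_mono[OF has_clique_Suc[OF assms(1)]])
     (use assms sym in \<open>auto simp: blue_def\<close>)

lemma card_split_at: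
  assumes "finite A" "v \<in> A"
  shows "card A = 1 + card (red A v) + card (blue A v)"
  using sum_split_at[OF assms, of "\<lambda>_. 1::nat"] by simp

text \<open>Pascal's rule splits the bound between the two neighbourhoods of a vertex. Using
  \<open>k + l\<close> instead of the sharper \<open>k + l - 2\<close> lets the induction end at
  cliques of size 0.\<close>

lemma erdos_szekeres:
  assumes "finite A" "(k + l) choose l \<le> card A"
  shows "red_clique A k \<or> blue_clique A l"
  using assms
proof (induction "k + l" arbitrary: A k l)
  case 0
  then show ?case by simp
next
  case (Suc n)
  show ?case
  proof (cases "k = 0 \<or> l = 0")
    case True
    then show ?thesis by auto
  next
    case False
    then obtain k' l' where kl: "k = Suc k'" "l = Suc l'"
      by (meson not0_implies_Suc)
    have "card A > 0" using Suc.prems(2) by (metis le_add2 not_le zero_less_binomial less_le_trans)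
    then obtain v where v: "v \<in> A" by fastforce
    have "(k + l) choose l = ((k' + l) choose l) + ((k + l') choose l')"
      by (simp add: kl)
    then have "((k' + l) choose l) \<le> card (red A v) \<or> ((k + l') choose l') \<le> card (blue A v)"
      using Suc.prems card_split_at[OF Suc.prems(1) v] by linarith
    then show ?thesis
    proof
      assume "((k' + l) choose l) \<le> card (red A v)"
      then have "red_clique (red A v) k' \<or> blue_clique (red A v) l"
        using Suc.hyps Suc.prems by (intro Suc.hyps) (auto simp: kl)
      then show ?thesis using red_clique_extend[of A v k' A] v kl has_clique_mono red_subset by blast
    next
      assume "((k + l') choose l') \<le> card (blue A v)"
      then have "red_clique (blue A v) k \<or> blue_clique (blue A v) l'"
        using Suc.hyps Suc.prems by (intro Suc.hyps) (auto simp: kl)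
      then show ?thesis using blue_clique_extend[of A v l' A] v kl has_clique_mono blue_subset by blast
    qed
  qed
qed

section \<open>The potential and its averages over codegrees\<close>

definition excess :: "real \<Rightarrow> 'a set \<Rightarrow> 'a \<Rightarrow> real" where
  "excess p Y w = max 0 (real (card (red Y w)) / real (card Y) - p)"

definition potential :: "real \<Rightarrow> nat \<Rightarrow> 'a set \<Rightarrow> 'a set \<Rightarrow> real" where
  "potential p c X Y = (\<Sum>w\<in>X. excess p Y w ^ c)"

lemma excess_nonneg [simp]: "excess p Y w \<ge> 0" by (simp add: excess_def)

lemma excess_le_1: "finite Y \<Longrightarrow> p \<ge> 0 \<Longrightarrow> excess p Y w \<le> 1"
proof -
  assume "finite Y" "p \<ge> 0"
  then have "real (card (red Y w)) / real (card Y) \<le> 1"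
    using card_mono[OF _ red_subset, of Y w] by (intro divide_le_eq_1[THEN iffD2]) linarith
  with \<open>p \<ge> 0\<close> show ?thesis by (auto simp: excess_def)
qed

lemma potential_nonneg [simp]: "potential p c X Y \<ge> 0"
  by (simp add: potential_def sum_nonneg)

text \<open>Double counting through \<open>y\<close>: with \<open>D y\<close> the weighted red
  degree of \<open>y\<close> into \<open>X\<close>, the claim compares the squared sum of
  \<open>D\<close> with \<open>card Y\<close> times the sum of its squares.\<close>

lemma codegree_sum_ge:
  fixes g :: "'a \<Rightarrow> real"
  assumes X: "finite X" and Y: "finite Y"
  shows "(\<Sum>v\<in>X. g v * card (red Y v))\<^sup>2
    \<le> card Y * (\<Sum>v\<in>X. \<Sum>w\<in>X. g v * (g w * card (red (red Y v) w)))"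
proof -
  define i where "i = (\<lambda>v y. if E v y then 1 else 0 :: real)"
  define D where "D y = (\<Sum>v\<in>X. g v * i v y)" for y
  have c1: "real (card (red Y v)) = (\<Sum>y\<in>Y. i v y)" for v
    using Y by (simp add: i_def red_def sum.If_cases Int_def)
  have c2: "real (card (red (red Y v) w)) = (\<Sum>y\<in>Y. i v y * i w y)" for v w
  proof -
    have "(\<Sum>y\<in>Y. i v y * i w y) = (\<Sum>y\<in>Y. if E v y \<and> E w y then 1 else 0)"
      by (rule sum.cong) (auto simp: i_def)
    then show ?thesis using Y by (simp add: red_def sum.If_cases Int_def conj_ac)
  qed
  have "(\<Sum>v\<in>X. g v * card (red Y v)) = (\<Sum>y\<in>Y. D y)"
    unfolding c1 D_def sum_distrib_left by (rule sum.swap)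
  moreover have "(\<Sum>v\<in>X. \<Sum>w\<in>X. g v * (g w * card (red (red Y v) w))) = (\<Sum>y\<in>Y. (D y)\<^sup>2)"
  proof -
    have "(\<Sum>v\<in>X. \<Sum>w\<in>X. g v * (g w * card (red (red Y v) w)))
      = (\<Sum>v\<in>X. \<Sum>w\<in>X. \<Sum>y\<in>Y. (g v * i v y) * (g w * i w y))"
      unfolding c2 sum_distrib_left by (intro sum.cong) auto
    also have "\<dots> = (\<Sum>v\<in>X. \<Sum>y\<in>Y. \<Sum>w\<in>X. (g v * i v y) * (g w * i w y))"
      by (intro sum.cong refl sum.swap)
    also have "\<dots> = (\<Sum>y\<in>Y. \<Sum>v\<in>X. \<Sum>w\<in>X. (g v * i v y) * (g w * i w y))"
      by (rule sum.swap)
    finally show ?thesis by (simp add: D_def power2_eq_square sum_product)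
  qed
  moreover have "(\<Sum>y\<in>Y. 1 * D y)\<^sup>2 \<le> (\<Sum>y\<in>Y. 1\<^sup>2) * (\<Sum>y\<in>Y. (D y)\<^sup>2)"
    by (rule Cauchy_Schwarz_ineq_sum)
  ultimately show ?thesis by simp
qed

text \<open>The Young inequality is applied with scale \<open>r\<close> on the red and
  \<open>b\<close> on the blue neighbours of \<open>v\<close>. This bounds the average of red
  densities into \<open>Y'\<close> by potentials before and after passing from \<open>Y\<close> to
  \<open>Y'\<close>.\<close>

lemma sum_excess_le_split:
  assumes fin: "finite X" and v: "v \<in> X" and f: "f = excess p Y" and sr: "r > 0" "b > 0"
    and Y': "Y' \<subseteq> Y" "finite Y" and p: "p \<ge> 0"
  shows "real (Suc m) * (\<Sum>w\<in>X. f w ^ m * (card (red Y' w) / card Y' - p))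
    \<le> real (Suc m) + potential p (Suc m) (red X v) Y' / r ^ m + real m * r * potential p (Suc m) (red X v) Y
      + potential p (Suc m) (blue X v) Y' / b ^ m + real m * b * potential p (Suc m) (blue X v) Y"
proof -
  define e where "e w = excess p Y' w" for w
  have pointwise: "real (Suc m) * (f w ^ m * (card (red Y' w) / card Y' - p)) \<le> real (Suc m) * (e w * f w ^ m)" for w
    unfolding mult.commute[of "e w"]
    by (intro mult_left_mono) (auto simp: e_def excess_def f)
  have part: "(\<Sum>w\<in>Z. real (Suc m) * (f w ^ m * (card (red Y' w) / card Y' - p)))
     \<le> potential p (Suc m) Z Y' / s ^ m + real m * s * potential p (Suc m) Z Y" if "s > 0" for Z s
  proof -
    have "(\<Sum>w\<in>Z. real (Suc m) * (f w ^ m * (card (red Y' w) / card Y' - p)))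
      \<le> (\<Sum>w\<in>Z. e w ^ Suc m / s ^ m + real m * s * f w ^ Suc m)"
      by (intro sum_mono order_trans[OF pointwise] pos_exponent_times_le_power_sum) (auto simp: e_def f that)
    then show ?thesis
      by (simp add: potential_def e_def f sum.distrib sum_divide_distrib sum_distrib_left)
  qed
  \<comment> \<open>The vertex \<open>v\<close> lies in neither of its neighbourhoods; its own term
    accounts for the summand \<open>real (Suc m)\<close>.\<close>
  have "e v * f v ^ m \<le> 1 * 1"
    using Y' p finite_subset[OF Y'] by (intro mult_mono power_le_one) (auto simp: e_def f excess_le_1)
  then have "real (Suc m) * (f v ^ m * (card (red Y' v) / card Y' - p)) \<le> real (Suc m)"
    using pointwise[of v] by (smt (verit) mult_left_le of_nat_0_le_iff)
  then show ?thesis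
    using part[OF sr(1), of "red X v"] part[OF sr(2), of "blue X v"]
    unfolding sum_distrib_left sum_split_at[OF fin v] distrib_left by linarith
qed


text \<open>Averaging over \<open>v\<close> with weights \<open>f v ^ m * card (red Y v)\<close> turns the right-hand side into a
  symmetric double sum of codegrees, to which the Cauchy--Schwarz inequality applies.\<close>

lemma exists_vertex_codegree_sum_ge:
  assumes X: "finite X" and Y: "finite Y" and p: "p \<ge> 0" and m: "m \<ge> 1"
    and f: "f = excess p Y" and pos: "potential p (Suc m) X Y > 0"
  shows "\<exists>v\<in>X. f v > 0 \<and> potential p (Suc m) X Y
    \<le> (\<Sum>w\<in>X. f w ^ m * (card (red (red Y v) w) / card (red Y v) - p))"
proof (rule ccontr)
  define Psi where "Psi = potential p (Suc m) X Y"
  define d where "d v = real (card (red Y v))" for v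
  define S where "S v = (\<Sum>w\<in>X. f w ^ m * (card (red (red Y v) w) / d v - p))" for v
  define T where "T = (\<Sum>v\<in>X. f v ^ m * d v)"
  assume none: "\<not> ?thesis"
  have less: "S v < Psi" if "v \<in> X" "f v > 0" for v
    using that none unfolding S_def d_def Psi_def not_le[symmetric] by blast
  have f0: "f v \<ge> 0" for v by (simp add: f)
  \<comment> \<open>Since \<open>m \<ge> 1\<close>, the weight \<open>f w ^ m\<close> vanishes
    exactly where the positive part differs from the plain difference.\<close>
  have Psi_eq: "Psi = (\<Sum>w\<in>X. f w ^ m * (d w / card Y - p))"
  proof -
    have "f w ^ Suc m = f w ^ m * (d w / card Y - p)" for w
      using m by (cases "f w = 0") (auto simp: power_0_left f excess_def d_def max_def split: if_splits)
    then show ?thesis by (simp add: Psi_def potential_def f del: power_Suc)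
  qed
  have dpos: "d v > 0" if "f v > 0" for v
    using that p by (auto simp: f excess_def d_def max_def split: if_splits intro!: Nat.gr0I)
  have "\<exists>v\<in>X. f v > 0"
  proof (rule ccontr)
    assume "\<not> ?thesis"
    then have "f v = 0" if "v \<in> X" for v using that f0[of v] by force
    then show False using pos by (simp add: potential_def f)
  qed
  then obtain u where u: "u \<in> X" "f u > 0" by blast
  have cY: "real (card Y) > 0"
    using dpos[OF u(2)] card_mono[OF Y red_subset[of Y u]] by (simp add: d_def)
  have "(\<Sum>v\<in>X. f v ^ m * d v * S v) < (\<Sum>v\<in>X. f v ^ m * d v * Psi)"
  proof (rule sum_strict_mono_ex1)
    show "\<forall>v\<in>X. f v ^ m * d v * S v \<le> f v ^ m * d v * Psi"
    proof
      fix v assume "v \<in> X"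
      show "f v ^ m * d v * S v \<le> f v ^ m * d v * Psi"
      proof (cases "f v = 0")
        case True
        then show ?thesis using m by (simp add: power_0_left)
      next
        case False
        then have "f v > 0" using f0[of v] by simp
        then show ?thesis using less[OF \<open>v \<in> X\<close>] dpos[of v] by (intro mult_left_mono) auto
      qed
    qed
    show "\<exists>v\<in>X. f v ^ m * d v * S v < f v ^ m * d v * Psi"
      using u less[OF u] dpos[OF u(2)] by (intro bexI[of _ u]) auto
  qed (rule X)
  also have "\<dots> = T * Psi" by (simp add: T_def sum_distrib_right)
  finally have lt: "(\<Sum>v\<in>X. f v ^ m * d v * S v) < T * Psi" .
  have "T\<^sup>2 \<le> card Y * (\<Sum>v\<in>X. \<Sum>w\<in>X. f v ^ m * (f w ^ m * card (red (red Y v) w)))"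
    unfolding T_def d_def by (rule codegree_sum_ge[OF X Y])
  then have "T\<^sup>2 / card Y \<le> (\<Sum>v\<in>X. \<Sum>w\<in>X. f v ^ m * (f w ^ m * card (red (red Y v) w)))"
    using cY by (simp add: divide_simps mult.commute)
  also have "\<dots> = (\<Sum>v\<in>X. f v ^ m * d v * S v) + p * T * (\<Sum>w\<in>X. f w ^ m)"
  proof -
    have "(\<Sum>w\<in>X. f v ^ m * (f w ^ m * card (red (red Y v) w)))
      = f v ^ m * d v * S v + p * (f v ^ m * d v) * (\<Sum>w\<in>X. f w ^ m)" for v
    proof (cases "f v = 0")
      case True
      then show ?thesis using m by (simp add: power_0_left)
    next
      case False
      then have "d v > 0" using dpos f0[of v] by (simp add: less_le)
      then have "f v ^ m * (f w ^ m * card (red (red Y v) w))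
        = f v ^ m * d v * (f w ^ m * (card (red (red Y v) w) / d v - p)) + p * (f v ^ m * d v) * f w ^ m" for w
        by (simp add: field_simps)
      then show ?thesis by (simp add: S_def sum_distrib_left sum.distrib)
    qed
    then show ?thesis by (simp add: T_def sum.distrib flip: sum_distrib_left sum_distrib_right)
  qed
  also have "\<dots> < T * Psi + p * T * (\<Sum>w\<in>X. f w ^ m)" using lt by simp
  \<comment> \<open>By \<open>Psi_eq\<close>, \<open>Psi\<close> equals \<open>T / card Y\<close>
    minus \<open>p\<close> times the sum of the weights, so the chain closes to a strict inequality
    between equal numbers.\<close>
  also have "\<dots> = T * (T / card Y)"
    by (simp add: Psi_eq T_def right_diff_distrib sum_subtractf sum_divide_distrib sum_distrib_left algebra_simps)
  finally show False by (simp add: power2_eq_square)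
qed

text \<open>If all three options failed, averaging and splitting would give
  \<open>Psi < 1 + (1 - delta) * Psi\<close>, which contradicts \<open>Psi \<ge> 1 / delta\<close>.
  The options are a blue step that keeps \<open>Y\<close>, a red step, and a blue step that shrinks
  \<open>Y\<close>.\<close>

lemma book_step:
  assumes X: "finite X" and Y: "finite Y" and p: "p \<ge> 0" and m: "m \<ge> 1"
    and mu: "0 < mu" "mu < 1" and delta: "delta > 0" and rb: "0 < r" "r \<le> b"
    and sub: "r * (1 - mu) + b * mu \<le> 1 - delta"
    and big: "potential p (Suc m) X Y \<ge> 1 / delta"
  obtains v where "v \<in> X" "p * card Y \<le> card (red Y v)" "card (red Y v) > 0"
    "mu * potential p (Suc m) X Y \<le> potential p (Suc m) (blue X v) Y
     \<or> (1 - mu) * r ^ Suc m * potential p (Suc m) X Y \<le> potential p (Suc m) (red X v) (red Y v)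
     \<or> mu * b ^ Suc m * potential p (Suc m) X Y \<le> potential p (Suc m) (blue X v) (red Y v)"
proof -
  define Psi where "Psi = potential p (Suc m) X Y"
  have "1 / delta > 0" using delta by simp
  then have Psi0: "Psi > 0" using big unfolding Psi_def by linarith
  obtain v where v: "v \<in> X" "excess p Y v > 0"
    and le: "Psi \<le> (\<Sum>w\<in>X. excess p Y w ^ m * (card (red (red Y v) w) / card (red Y v) - p))"
    using exists_vertex_codegree_sum_ge[OF X Y p m refl Psi0[unfolded Psi_def]] unfolding Psi_def by blast
  have gt: "real (card (red Y v)) / card Y > p"
    using v(2) by (simp add: excess_def less_max_iff_disj)
  \<comment> \<open>For empty \<open>Y\<close> the quotient is 0 by convention, so it could not
    exceed \<open>p\<close>.\<close>
  have cY: "card Y > 0" using gt p by (cases "card Y = 0") auto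
  have 1: "p * card Y \<le> card (red Y v)"
    using gt cY by (simp add: pos_less_divide_eq)
  have 2: "card (red Y v) > 0"
    using gt p by (intro Nat.gr0I) simp
  have 3: "mu * Psi \<le> potential p (Suc m) (blue X v) Y
     \<or> (1 - mu) * r ^ Suc m * Psi \<le> potential p (Suc m) (red X v) (red Y v)
     \<or> mu * b ^ Suc m * Psi \<le> potential p (Suc m) (blue X v) (red Y v)"
  proof (rule ccontr)
    define R where "R = potential p (Suc m) (red X v) Y"
    define B where "B = potential p (Suc m) (blue X v) Y"
    define R' where "R' = potential p (Suc m) (red X v) (red Y v)"
    define B' where "B' = potential p (Suc m) (blue X v) (red Y v)"
    assume "\<not> ?thesis"
    then have B: "B < mu * Psi" and R': "R' < (1 - mu) * r ^ Suc m * Psi" and B': "B' < mu * b ^ Suc m * Psi"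
      unfolding B_def R'_def B'_def de_Morgan_disj not_le by blast+
    have RB: "R + B \<le> Psi"
      using sum_split_at[OF X v(1), of "\<lambda>w. excess p Y w ^ Suc m"]
      by (simp add: R_def B_def Psi_def potential_def)
    have b: "b > 0" using rb by simp
    have R'': "R' / r ^ m < (1 - mu) * r * Psi" using R' rb by (simp add: pos_divide_less_eq mult_ac)
    have B'': "B' / b ^ m < mu * b * Psi" using B' b by (simp add: pos_divide_less_eq mult_ac)
    \<comment> \<open>As \<open>r \<le> b\<close>, the left side is largest when \<open>B\<close>
      takes its full allowance \<open>mu * Psi\<close> and \<open>R\<close> the rest.\<close>
    have lin: "r * R + b * B \<le> (r * (1 - mu) + b * mu) * Psi"
    proof -
      have "r * R + b * B \<le> r * (Psi - B) + b * B" using RB rb by (intro add_mono mult_left_mono) auto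
      also have "\<dots> = r * Psi + (b - r) * B" by (simp add: algebra_simps)
      also have "\<dots> \<le> r * Psi + (b - r) * (mu * Psi)" using rb B by (intro add_mono mult_left_mono) auto
      finally show ?thesis by (simp add: algebra_simps)
    qed
    have "real (Suc m) * Psi \<le> real (Suc m) * (\<Sum>w\<in>X. excess p Y w ^ m * (card (red (red Y v) w) / card (red Y v) - p))"
      using le by (intro mult_left_mono) auto
    also have "\<dots> \<le> real (Suc m) + R' / r ^ m + real m * r * R + B' / b ^ m + real m * b * B"
      unfolding R_def B_def R'_def B'_def
      using sum_excess_le_split[OF X v(1) refl rb(1) b red_subset Y p] .
    also have "\<dots> = real (Suc m) + R' / r ^ m + B' / b ^ m + real m * (r * R + b * B)"
      by (simp add: algebra_simps)
    also have "\<dots> < real (Suc m) + (1 - mu) * r * Psi + mu * b * Psi + real m * ((r * (1 - mu) + b * mu) * Psi)"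
      using R'' B'' mult_left_mono[OF lin, of "real m"] by linarith
    also have "\<dots> = real (Suc m) * (1 + (r * (1 - mu) + b * mu) * Psi)"
      by (simp add: algebra_simps)
    also have "\<dots> \<le> real (Suc m) * (1 + (1 - delta) * Psi)"
      using sub Psi0 by (intro mult_left_mono add_left_mono mult_right_mono) auto
    finally have "Psi < 1 + (1 - delta) * Psi" by (subst (asm) mult_less_cancel_left_pos) auto
    then have "delta * Psi < 1" by (simp add: algebra_simps)
    then show False using big delta unfolding Psi_def by (simp add: divide_simps mult.commute)
  qed
  show thesis by (rule that[OF v(1) 1 2 3[unfolded Psi_def]])
qed

section \<open>From a large potential to a clique\<close>

lemma choose_le_inverse_powers:
  fixes x y :: real
  assumes "x > 0" "y > 0" "x + y = 1"
  shows "real ((k + l) choose l) \<le> 1 / (x ^ k * y ^ l)"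
proof -
  \<comment> \<open>A single term of the expansion of \<open>(y + x) ^ (k + l) = 1\<close>.\<close>
  have "real ((k + l) choose l) * y ^ l * x ^ (k + l - l) \<le> (\<Sum>i\<le>k + l. real ((k + l) choose i) * y ^ i * x ^ (k + l - i))"
    using assms by (intro member_le_sum) auto
  also have "\<dots> = (y + x) ^ (k + l)" by (rule binomial_ring[symmetric])
  finally have "real ((k + l) choose l) * (x ^ k * y ^ l) \<le> 1"
    using assms by (simp add: add.commute mult_ac)
  then show ?thesis using assms by (simp add: pos_le_divide_eq)
qed

text \<open>The hypothesis \<open>big\<close> is preserved by every step: a red step keeps at least
  the fraction \<open>x\<close> of the potential times \<open>card Y\<close>, a blue step at least
  \<open>mu\<close>. Red steps restrict both sets, so red cliques live in
  \<open>X \<union> Y\<close>; blue steps build only in \<open>X\<close>. The blue target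
  \<open>L\<close> in \<open>Y\<close> is therefore separate and stays fixed.\<close>

lemma clique_of_potential:
  assumes X: "finite X" and Y: "finite Y" and p: "p \<ge> 0" and m: "m \<ge> 1"
    and mu: "0 < mu" "mu < 1" and delta: "delta > 0" and rb: "0 < r" "r \<le> b"
    and sub: "r * (1 - mu) + b * mu \<le> 1 - delta"
    and xy: "0 < x" "0 < y" "x + y = 1"
    and xr: "x \<le> p * (1 - mu) * r ^ Suc m" and pb: "1 \<le> p * b ^ Suc m"
    and big: "1 \<le> delta * x ^ k * mu ^ l * y ^ L * (potential p (Suc m) X Y * card Y)"
  shows "red_clique (X \<union> Y) k \<or> blue_clique Y L \<or> blue_clique X l"
  using X Y big
proof (induction "k + l" arbitrary: X Y k l)
  case 0
  then show ?case by simp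
next
  case (Suc n)
  define Psi where "Psi = potential p (Suc m) X Y"
  note X = Suc.prems(1) and Y = Suc.prems(2) and big = Suc.prems(3)
  show ?case
  proof (cases "k = 0 \<or> l = 0")
    case True
    then show ?thesis by auto
  next
    case False
    then obtain k' l' where kl: "k = Suc k'" "l = Suc l'"
      by (meson not0_implies_Suc)
    have Psi0: "Psi \<ge> 0" by (simp add: Psi_def)
    show ?thesis
    proof (cases "Psi \<ge> 1 / delta")
      case False
      \<comment> \<open>Now \<open>delta * Psi \<le> 1\<close>, so \<open>big\<close> turns into a
        lower bound on \<open>card Y\<close> alone, enough for Erdos--Szekeres inside
        \<open>Y\<close>.\<close>
      have "1 \<le> (delta * Psi) * mu ^ l * (x ^ k * y ^ L * card Y)"
        using big by (simp add: Psi_def mult_ac)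
      also have "\<dots> \<le> 1 * 1 * (x ^ k * y ^ L * card Y)"
        using False delta mu xy Psi0
        by (intro mult_right_mono mult_mono power_le_one) (auto simp: field_simps)
      finally have "1 / (x ^ k * y ^ L) \<le> card Y" using xy by (simp add: field_simps)
      then have "real ((k + L) choose L) \<le> real (card Y)"
        using choose_le_inverse_powers[OF xy, of k L] by linarith
      then have "red_clique Y k \<or> blue_clique Y L" using erdos_szekeres[OF Y] by simp
      then show ?thesis using has_clique_mono by blast
    next
      case True
      obtain v where v: "v \<in> X" and vY: "p * card Y \<le> card (red Y v)" "card (red Y v) > 0"
        and opts: "mu * Psi \<le> potential p (Suc m) (blue X v) Y
          \<or> (1 - mu) * r ^ Suc m * Psi \<le> potential p (Suc m) (red X v) (red Y v)
          \<or> mu * b ^ Suc m * Psi \<le> potential p (Suc m) (blue X v) (red Y v)"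
        using book_step[OF X Y p m mu delta rb sub] True unfolding Psi_def by metis
      have fin: "finite (red X v)" "finite (blue X v)" "finite (red Y v)" using X Y by auto
      \<comment> \<open>Both blue options end this way, with \<open>Z = Y\<close> or
        \<open>Z = red Y v\<close>.\<close>
      have blue: ?thesis if "red_clique (blue X v \<union> Z) k \<or> blue_clique Z L \<or> blue_clique (blue X v) l'" "Z \<subseteq> Y" for Z
      proof -
        have "blue X v \<union> Z \<subseteq> X \<union> Y" using that(2) blue_subset[of X v] by auto
        then show ?thesis
          using that has_clique_mono blue_clique_extend[of X v l' X] v kl by blast
      qed
      consider "mu * Psi \<le> potential p (Suc m) (blue X v) Y"
        | "(1 - mu) * r ^ Suc m * Psi \<le> potential p (Suc m) (red X v) (red Y v)"
        | "mu * b ^ Suc m * Psi \<le> potential p (Suc m) (blue X v) (red Y v)" using opts by blast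
      then show ?thesis
      proof cases
        case 1
        have "1 \<le> (delta * x ^ k * mu ^ l' * y ^ L) * ((mu * Psi) * card Y)"
          using big by (simp add: Psi_def kl mult_ac)
        also have "\<dots> \<le> (delta * x ^ k * mu ^ l' * y ^ L) * (potential p (Suc m) (blue X v) Y * card Y)"
          using 1 delta mu xy by (intro mult_left_mono mult_right_mono) auto
        finally have "red_clique (blue X v \<union> Y) k \<or> blue_clique Y L \<or> blue_clique (blue X v) l'"
          using Suc.hyps(2) kl by (intro Suc.hyps(1) fin Y) auto
        then show ?thesis using blue by blast
      next
        case 2
        have "1 \<le> (delta * x ^ k' * mu ^ l * y ^ L) * (Psi * card Y) * x"
          using big by (simp add: Psi_def kl mult_ac)
        also have "\<dots> \<le> (delta * x ^ k' * mu ^ l * y ^ L) * (Psi * card Y) * (p * (1 - mu) * r ^ Suc m)"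
          using xr delta mu xy Psi0 by (intro mult_left_mono) auto
        also have "\<dots> = (delta * x ^ k' * mu ^ l * y ^ L) * (((1 - mu) * r ^ Suc m * Psi) * (p * card Y))"
          by (simp add: mult_ac)
        also have "\<dots> \<le> (delta * x ^ k' * mu ^ l * y ^ L) * (potential p (Suc m) (red X v) (red Y v) * card (red Y v))"
          using 2 vY delta mu xy p by (intro mult_left_mono mult_mono) auto
        finally have "red_clique (red X v \<union> red Y v) k' \<or> blue_clique (red Y v) L \<or> blue_clique (red X v) l"
          using Suc.hyps(2) kl by (intro Suc.hyps(1) fin) auto
        moreover have "red X v \<union> red Y v = red (X \<union> Y) v" by (auto simp: red_def)
        ultimately show ?thesis
          using has_clique_mono red_subset red_clique_extend[of "X \<union> Y" v k' "X \<union> Y"] v kl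
          by (metis UnI1 subset_refl)
      next
        case 3
        have "1 \<le> (delta * x ^ k * mu ^ l' * y ^ L) * (mu * Psi * card Y) * 1"
          using big by (simp add: Psi_def kl mult_ac)
        \<comment> \<open>Shrinking \<open>Y\<close> may cost a factor \<open>p\<close>, which the
          gain \<open>b ^ Suc m\<close> in the potential repays.\<close>
        also have "\<dots> \<le> (delta * x ^ k * mu ^ l' * y ^ L) * (mu * Psi * card Y) * (p * b ^ Suc m)"
          using pb delta mu xy Psi0 by (intro mult_left_mono) auto
        also have "\<dots> = (delta * x ^ k * mu ^ l' * y ^ L) * ((mu * b ^ Suc m * Psi) * (p * card Y))"
          by (simp add: mult_ac)
        also have "\<dots> \<le> (delta * x ^ k * mu ^ l' * y ^ L) * (potential p (Suc m) (blue X v) (red Y v) * card (red Y v))"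
          using 3 vY delta mu xy p by (intro mult_left_mono mult_mono) auto
        finally have "red_clique (blue X v \<union> red Y v) k \<or> blue_clique (red Y v) L \<or> blue_clique (blue X v) l'"
          using Suc.hyps(2) kl by (intro Suc.hyps(1) fin) auto
        then show ?thesis using blue red_subset by blast
      qed
    qed
  qed
qed

end

section \<open>Ramsey numbers and binomial coefficients\<close>

lemma ramsey_number_leI:
  assumes "\<And>E. red_graph E \<Longrightarrow> has_clique E {..<N} k \<or> has_clique (\<lambda>u v. \<not> E u v) {..<N} l"
  shows "ramsey_number k l \<le> N"
  unfolding ramsey_number_le_iff partn_lst_two_colours
proof (intro allI impI)
  fix f :: "nat set \<Rightarrow> nat"
  assume f: "\<forall>e\<in>[{..<N}]\<^bsup>2\<^esup>. f e = 0 \<or> f e = 1"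
  define E where "E u v \<longleftrightarrow> u \<noteq> v \<and> f {u, v} = 0" for u v
  have "red_graph E" by unfold_locales (auto simp: E_def insert_commute)
  then have "has_clique E {..<N} k \<or> has_clique (\<lambda>u v. \<not> E u v) {..<N} l" by (rule assms)
  then show "(\<exists>R\<subseteq>{..<N}. card R = k \<and> (\<forall>e\<in>[R]\<^bsup>2\<^esup>. f e = 0)) \<or>
    (\<exists>B\<subseteq>{..<N}. card B = l \<and> (\<forall>e\<in>[B]\<^bsup>2\<^esup>. f e = 1))"
  proof
    assume "has_clique E {..<N} k"
    then obtain S where "S \<subseteq> {..<N}" "card S = k" "\<forall>u\<in>S. \<forall>v\<in>S. u \<noteq> v \<longrightarrow> E u v"
      unfolding has_clique_def by blast
    then show ?thesis by (auto simp: E_def nsets_def card_2_iff)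
  next
    assume "has_clique (\<lambda>u v. \<not> E u v) {..<N} l"
    then obtain S where S: "S \<subseteq> {..<N}" "card S = l" "\<forall>u\<in>S. \<forall>v\<in>S. u \<noteq> v \<longrightarrow> \<not> E u v"
      unfolding has_clique_def by blast
    have "f e = 1" if "e \<in> [S]\<^bsup>2\<^esup>" for e
    proof -
      have "e \<in> [{..<N}]\<^bsup>2\<^esup>" using that S(1) by (auto simp: nsets_def)
      moreover have "f e \<noteq> 0" using that S(3) by (auto simp: E_def nsets_def card_2_iff)
      ultimately show ?thesis using f by auto
    qed
    then show ?thesis using S by blast
  qed
qed

text \<open>Transfer along a bijection with \<open>{..<card A}\<close>. It lets the bound for a
  smaller \<open>l\<close> be applied to blue neighbourhoods, which are arbitrary finite
  sets.\<close>

lemma (in red_graph) clique_if_ramsey_number_le: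
  assumes "finite A" "ramsey_number k l \<le> card A"
  shows "red_clique A k \<or> blue_clique A l"
proof -
  obtain h where h: "bij_betw h {..<card A} A"
    using ex_bij_betw_nat_finite[OF assms(1)] by (auto simp: atLeast0LessThan)
  define f where "f e = (if \<exists>u v. e = {u, v} \<and> E (h u) (h v) then 0 else 1 :: nat)" for e
  have f_edge: "f {u, v} = (if E (h u) (h v) then 0 else 1)" for u v
    using sym by (auto simp: f_def doubleton_eq_iff)
  have clique: "has_clique P A m"
    if H: "H \<subseteq> {..<card A}" "card H = m" "\<And>u v. u \<in> H \<Longrightarrow> v \<in> H \<Longrightarrow> u \<noteq> v \<Longrightarrow> P (h u) (h v)" for H m P
  proof -
    have "inj_on h H" using h H(1) by (auto simp: bij_betw_def intro: inj_on_subset)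
    then have "card (h ` H) = m" "finite (h ` H)"
      using H(2) finite_subset[OF H(1)] by (auto simp: card_image)
    moreover have "h ` H \<subseteq> A" using h H(1) by (auto simp: bij_betw_def)
    ultimately show ?thesis using H(3) unfolding has_clique_def by (intro exI[of _ "h ` H"]) auto
  qed
  have pair: "{u, v} \<in> [H]\<^bsup>2\<^esup>" if "u \<in> H" "v \<in> H" "u \<noteq> v" for u v and H :: "nat set"
    using that by (auto simp: nsets_def)
  have "\<forall>e\<in>[{..<card A}]\<^bsup>2\<^esup>. f e = 0 \<or> f e = 1" by (simp add: f_def)
  then consider R where "R \<subseteq> {..<card A}" "card R = k" "\<forall>e\<in>[R]\<^bsup>2\<^esup>. f e = 0"
    | B where "B \<subseteq> {..<card A}" "card B = l" "\<forall>e\<in>[B]\<^bsup>2\<^esup>. f e = 1"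
    using assms(2) unfolding ramsey_number_le_iff partn_lst_two_colours by blast
  then show ?thesis
  proof cases
    case 1
    have "E (h u) (h v)" if "u \<in> R" "v \<in> R" "u \<noteq> v" for u v
      using 1(3)[rule_format, OF pair[OF that]] by (auto simp: f_edge split: if_splits)
    then show ?thesis using clique[OF 1(1,2)] by blast
  next
    case 2
    have "\<not> E (h u) (h v)" if "u \<in> B" "v \<in> B" "u \<noteq> v" for u v
      using 2(3)[rule_format, OF pair[OF that]] by (auto simp: f_edge split: if_splits)
    then show ?thesis using clique[OF 2(1,2), of "\<lambda>u v. \<not> E u v"] by blast
  qed
qed

lemma ramsey_number_le_choose: "ramsey_number k l \<le> (k + l) choose l"
  by (rule ramsey_number_leI, rule red_graph.erdos_szekeres) auto

text \<open>In the expansion of \<open>(l + k) ^ (k + l)\<close> the term with index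
  \<open>l\<close> is the largest of the \<open>k + l + 1\<close> terms. This gives the entropy
  lower bound for the binomial coefficient up to a polynomial factor.\<close>

lemma power_le_choose_times:
  "real (k + l) ^ (k + l) \<le> real (k + l + 1) * (real ((k + l) choose l) * real l ^ l * real k ^ k)"
proof -
  define n where "n = k + l"
  define t where "t j = real (n choose j) * real l ^ j * real k ^ (n - j)" for j
  \<comment> \<open>Consecutive terms compare like \<open>(n - j) * l\<close> and
    \<open>Suc j * k\<close>, so they increase up to \<open>j = l\<close> and decrease
    afterwards.\<close>
  have step: "real (Suc j) * real k * t (Suc j) = real (n - j) * real l * t j" if "j < n" for j
  proof -
    have "real (Suc j) * real (n choose Suc j) = real (n - j) * real (n choose j)"
      using binomial_absorption[of j n] binomial_absorb_comp[of n j]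
      by (metis of_nat_mult)
    moreover have "real k ^ (n - j) = real k * real k ^ (n - Suc j)"
      using that by (metis Suc_diff_Suc power_Suc)
    ultimately show ?thesis by (simp add: t_def del: of_nat_Suc)
  qed
  have t0: "t j \<ge> 0" for j by (simp add: t_def)
  have up: "t j \<le> t (Suc j)" if "j < l" for j
  proof (cases "k = 0")
    case True
    then have "n - j > 0" using that by (simp add: n_def)
    then have "t j = 0" using True by (simp add: t_def)
    then show ?thesis by (simp add: t0)
  next
    case False
    have "Suc j * k \<le> l * (n - j)" by (rule mult_le_mono) (use that in \<open>auto simp: n_def\<close>)
    then have "real (Suc j) * real k \<le> real (n - j) * real l"
      by (metis mult.commute of_nat_le_iff of_nat_mult)
    then have "real (Suc j) * real k * t j \<le> real (n - j) * real l * t j"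
      by (intro mult_right_mono t0)
    also have "\<dots> = real (Suc j) * real k * t (Suc j)" using step[of j] that by (simp add: n_def)
    finally show ?thesis using False by (simp del: of_nat_Suc)
  qed
  have down: "t (Suc j) \<le> t j" if "l \<le> j" "j < n" for j
  proof -
    have "(n - j) * l \<le> k * Suc j" by (rule mult_le_mono) (use that in \<open>auto simp: n_def\<close>)
    then have "real (n - j) * real l \<le> real (Suc j) * real k"
      by (metis mult.commute of_nat_le_iff of_nat_mult)
    then have "real (n - j) * real l * t j \<le> real (Suc j) * real k * t j"
      by (intro mult_right_mono t0)
    then have "real (Suc j) * real k * t (Suc j) \<le> real (Suc j) * real k * t j"
      using step[of j] that by simp
    moreover have "k > 0" using that by (simp add: n_def)
    ultimately show ?thesis by (simp del: of_nat_Suc)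
  qed
  have le: "t j \<le> t l" if "j \<le> n" for j
  proof (cases "j \<le> l")
    case True
    then show ?thesis by (induction rule: inc_induct) (use up in \<open>auto intro: order_trans\<close>)
  next
    case False
    then have "l \<le> j" by simp
    then show ?thesis using that
      by (induction rule: dec_induct) (use down in \<open>auto intro: order_trans[OF down]\<close>)
  qed
  have "real n ^ n = (\<Sum>j\<le>n. t j)"
    using binomial_ring[of "real l" "real k" n] by (simp add: t_def n_def add.commute)
  also have "\<dots> \<le> (\<Sum>j\<le>n. t l)" using le by (intro sum_mono) auto
  also have "\<dots> = real (n + 1) * t l" by simp
  finally show ?thesis by (simp add: n_def t_def)
qed

section \<open>Estimates for the parameters\<close>

lemma ln_chord:
  fixes t x :: real
  assumes "0 \<le> t" "t \<le> 1" "x > 0"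
  shows "t * ln x \<le> ln (1 - t * (1 - x))"
  using concave_onD[OF ln_concave assms(1,2), of 1 x] assms(3) by (simp add: algebra_simps)

lemma x_ln_x_chord:
  fixes t x :: real
  assumes "0 \<le> t" "t \<le> 1" "x > 0"
  shows "(1 - t * (1 - x)) * ln (1 - t * (1 - x)) \<le> t * (x * ln x)"
proof -
  have "convex_on {0<..} (\<lambda>x::real. x * ln x)"
  proof (rule convex_on_realI)
    show "((\<lambda>x. x * ln x) has_real_derivative ln x + 1) (at x)" if "x \<in> {0<..}" for x :: real
      using that by (auto intro!: derivative_eq_intros)
  qed auto
  from convex_onD[OF this assms(1,2), of 1 x] assms(3) show ?thesis by (simp add: algebra_simps)
qed

text \<open>With \<open>t = mu / (1 - mu)\<close> the left side is
  \<open>(1 - mu) * p * p powr t\<close>, and the chord bound for \<open>p powr t\<close> makes it a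
  cubic in \<open>mu\<close>. Replacing \<open>mu\<^sup>2\<close> by 1/25 in the cubic term gives
  13/6 - 49/900 = 1901/900.\<close>

lemma red_ratio_le:
  fixes mu :: real
  assumes "0 < mu" "mu \<le> 1 / 5"
  shows "(1 - mu) * (1 - 7/6 * mu) powr (1 / (1 - mu)) \<le> 1 - 1901/900 * mu"
proof -
  define p where "p = 1 - 7/6 * mu"
  define t where "t = mu / (1 - mu)"
  have p: "p > 0" and t: "0 \<le> t" "t \<le> 1" using assms by (auto simp: p_def t_def field_simps)
  have tp: "1 - t * (1 - p) > 0"
  proof -
    have "t * (1 - p) \<le> 1 * (1 - p)" using t assms by (intro mult_right_mono) (auto simp: p_def)
    then show ?thesis using p by simp
  qed
  have "p powr t = exp (t * ln p)" using p by (simp add: powr_def)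
  also have "\<dots> \<le> exp (ln (1 - t * (1 - p)))" using ln_chord[OF t p] by simp
  also have "\<dots> = 1 - t * (1 - p)" using tp by simp
  finally have pt: "p powr t \<le> 1 - t * (1 - p)" .
  have "1 / (1 - mu) = 1 + t" using assms by (simp add: t_def field_simps)
  then have "(1 - mu) * p powr (1 / (1 - mu)) = (1 - mu) * p * p powr t"
    using p by (simp add: powr_add)
  also have "\<dots> \<le> (1 - mu) * p * (1 - t * (1 - p))"
    using pt p assms by (intro mult_left_mono) auto
  also have "\<dots> = 1 - 13/6 * mu + (7/6)\<^sup>2 * (mu * mu\<^sup>2)"
    using assms by (simp add: t_def p_def field_simps power2_eq_square)
  also have "\<dots> \<le> 1 - 13/6 * mu + (7/6)\<^sup>2 * (mu * (1/5)\<^sup>2)"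
    using assms by (intro add_left_mono mult_left_mono power_mono) auto
  finally show ?thesis by (simp add: p_def power2_eq_square)
qed

text \<open>The left side is convex, the right side concave, and both vanish at
  \<open>mu = 0\<close>, so the endpoint \<open>mu = 1/5\<close> decides. The coefficient 4/9 is
  twice 2/9 because the Ramsey bound will enter squared.\<close>

lemma entropy_inequality:
  fixes mu :: real
  assumes "0 < mu" "mu \<le> 1 / 5"
  shows "(1 - mu) * ln (1 - mu) + 4/9 * mu * ln 2 \<le> ln (1 - 7/6 * mu) + mu * ln (1901/900)"
proof -
  define t where "t = 5 * mu"
  have t: "0 \<le> t" "t \<le> 1" and mu: "mu = t / 5" using assms by (auto simp: t_def)
  have 1: "(1 - mu) * ln (1 - mu) \<le> t * (4/5 * ln (4/5))"
    using x_ln_x_chord[OF t, of "4/5"] by (simp add: mu)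
  have 2: "t * ln (23/30) \<le> ln (1 - 7/6 * mu)"
    using ln_chord[OF t, of "23/30"] by (simp add: mu mult.commute)
  \<comment> \<open>The endpoint inequality multiplied by 45 and exponentiated; 23/30 is
    \<open>1 - 7/6 * mu\<close> at \<open>mu = 1/5\<close>.\<close>
  have "(4/5::real) ^ 36 * 2 ^ 4 \<le> (23/30) ^ 45 * (1901/900) ^ 9" by (simp add: field_simps)
  then have "ln ((4/5::real) ^ 36 * 2 ^ 4) \<le> ln ((23/30) ^ 45 * (1901/900) ^ 9)"
    by (intro ln_mono) auto
  moreover have "ln (x ^ i * y ^ j) = real i * ln x + real j * ln y" if "x > 0" "y > 0"
    for x y :: real and i j
    using that by (simp add: ln_mult ln_realpow)
  ultimately have "36 * ln (4/5::real) + 4 * ln 2 \<le> 45 * ln (23/30) + 9 * ln (1901/900)"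
    by (metis (no_types, lifting) of_nat_numeral zero_less_numeral zero_less_divide_iff)
  then have "4/5 * ln (4/5::real) + 4/45 * ln 2 \<le> ln (23/30) + 1/5 * ln (1901/900)" by simp
  then have "t * (4/5 * ln (4/5::real) + 4/45 * ln 2) \<le> t * (ln (23/30) + 1/5 * ln (1901/900))"
    using t by (intro mult_left_mono) auto
  then have "t * (4/5 * ln (4/5::real)) + 4/9 * mu * ln 2 \<le> t * ln (23/30) + mu * ln (1901/900)"
    by (simp add: mu algebra_simps)
  then show ?thesis using 1 2 by linarith
qed

lemma exp_minus_le_quadratic:
  fixes z :: real
  assumes "z \<ge> 0"
  shows "exp (- z) \<le> 1 - z + z\<^sup>2"
proof -
  have "exp (- z) \<le> 1 / (1 + z)"
    using exp_ge_add_one_self[of z] assms by (simp add: exp_minus inverse_eq_divide divide_left_mono)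
  also have "\<dots> \<le> 1 - z + z\<^sup>2"
  proof -
    have "(1 - z + z\<^sup>2) * (1 + z) = 1 + z ^ 3" by algebra
    then show ?thesis using assms by (simp add: pos_divide_le_eq)
  qed
  finally show ?thesis .
qed

text \<open>With \<open>c = Suc m\<close> the choice is \<open>r ^ c = p powr (mu / (1 - mu)) * 2 powr (- eta)\<close> and \<open>b ^ c = 1 / p\<close>; to
  first order in \<open>1 / c\<close> the powers of \<open>p\<close> cancel in \<open>r * (1 - mu) + b * mu\<close>, and \<open>eta\<close> leaves room
  for a \<open>delta\<close> that does not depend on \<open>p\<close> and \<open>mu\<close>.\<close>

lemma exists_book_parameters:
  fixes eta :: real
  assumes eta: "0 < eta" "eta \<le> 1"
  obtains m delta where "m \<ge> 1" "delta > 0"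
    "\<And>p mu. 1/2 \<le> p \<Longrightarrow> p < 1 \<Longrightarrow> 0 < mu \<Longrightarrow> mu \<le> 1/5 \<Longrightarrow>
      \<exists>r b. 0 < r \<and> r \<le> b \<and> r * (1 - mu) + b * mu \<le> 1 - delta \<and>
        (1 - mu) * p powr (1 / (1 - mu)) * 2 powr (- eta) \<le> p * (1 - mu) * r ^ Suc m \<and>
        1 \<le> p * b ^ Suc m"
proof -
  obtain m :: nat where m: "real m \<ge> 4 / eta" using real_arch_simple by blast
  define c where "c = real (Suc m)"
  define delta where "delta = eta / (4 * c)"
  have "4 / eta \<ge> 4" using eta by (simp add: field_simps)
  then have m1: "m \<ge> 1" and c: "c \<ge> 4" "c \<ge> 4 / eta" using m by (auto simp: c_def)
  have delta: "delta > 0" using eta c by (simp add: delta_def)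
  show thesis
  proof (rule that[OF m1 delta])
    fix p mu :: real
    assume p: "1/2 \<le> p" "p < 1" and mu: "0 < mu" "mu \<le> 1/5"
    define P where "P = - ln p"
    define t where "t = P * (mu / (1 - mu)) + eta * ln 2"
    define r where "r = exp (- (t / c))"
    define b where "b = exp (P / c)"
    have ln2: "ln 2 \<le> (3/4::real)" "ln 2 \<ge> (5/8::real)"
      using ln2_le_25_over_36 ln2_ge_two_thirds by auto
    have "ln (1/2) \<le> ln p" using p by (intro ln_mono) auto
    then have P: "0 \<le> P" "P \<le> 1" using p ln2 by (auto simp: P_def ln_div)
    have frac: "0 \<le> mu / (1 - mu)" "mu / (1 - mu) \<le> 1/4" using mu by (auto simp: field_simps)
    have t: "0 \<le> t" "t \<le> 1"
    proof -
      show "0 \<le> t" unfolding t_def using P frac eta by (intro add_nonneg_nonneg mult_nonneg_nonneg) auto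
      have "P * (mu / (1 - mu)) \<le> 1 * (1/4)" using P frac by (intro mult_mono) auto
      moreover have "eta * ln 2 \<le> 1 * (3/4)" using eta ln2 by (intro mult_mono) auto
      ultimately show "t \<le> 1" unfolding t_def by linarith
    qed
    have quad: "z / c \<le> 1" "(z / c)\<^sup>2 \<le> 1 / c\<^sup>2" if "0 \<le> z" "z \<le> 1" for z
      using that c by (auto simp: power_divide divide_simps power_le_one)
    have r: "r \<le> 1 - t / c + 1 / c\<^sup>2"
      using exp_minus_le_quadratic[of "t / c"] quad[OF t] t c by (simp add: r_def)
    have b: "b \<le> 1 + P / c + 1 / c\<^sup>2"
      using exp_bound[of "P / c"] quad[OF P] P c by (simp add: b_def)
    have "r * (1 - mu) + b * mu \<le> (1 - t / c + 1 / c\<^sup>2) * (1 - mu) + (1 + P / c + 1 / c\<^sup>2) * mu"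
      using r b mu by (intro add_mono mult_right_mono) auto
    also have "\<dots> = 1 - (t * (1 - mu) - P * mu) / c + 1 / c\<^sup>2"
      by (simp add: algebra_simps diff_divide_distrib add_divide_distrib)
    also have "t * (1 - mu) - P * mu = eta * (ln 2 * (1 - mu))"
      using mu by (simp add: t_def distrib_right)
    \<comment> \<open>The first-order gain is at least \<open>eta / (2 * c)\<close>, and
      \<open>c \<ge> 4 / eta\<close> keeps the second-order error below
      \<open>eta / (4 * c)\<close>; the difference is \<open>delta\<close>.\<close>
    also have "1 - eta * (ln 2 * (1 - mu)) / c + 1 / c\<^sup>2 \<le> 1 - eta * (1/2) / c + (eta / 4) / c"
    proof -
      have "(5/8) * (4/5) \<le> ln 2 * (1 - mu)" using mu ln2 by (intro mult_mono) auto
      then have "eta * (1/2) / c \<le> eta * (ln 2 * (1 - mu)) / c"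
        using eta c by (intro divide_right_mono mult_left_mono) auto
      moreover have "1 / c\<^sup>2 \<le> (eta / 4) / c"
        using eta c by (simp add: power2_eq_square field_simps)
      ultimately show ?thesis by linarith
    qed
    also have "\<dots> = 1 - delta" by (simp add: delta_def)
    finally have sub: "r * (1 - mu) + b * mu \<le> 1 - delta" .
    have "r ^ Suc m = exp (- t)" and b_pow: "b ^ Suc m = exp P"
      unfolding r_def b_def exp_of_nat_mult[symmetric] by (simp_all add: c_def del: of_nat_Suc)
    moreover have "p powr (1 / (1 - mu)) * 2 powr (- eta) = p * exp (- t)"
    proof -
      have "1 / (1 - mu) = 1 + mu / (1 - mu)" using mu by (simp add: field_simps)
      then have "1 / (1 - mu) * ln p + - eta * ln 2 = ln p + - t"
        by (simp add: t_def P_def algebra_simps)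
      then have "exp (1 / (1 - mu) * ln p) * exp (- eta * ln 2) = exp (ln p) * exp (- t)"
        by (simp only: flip: exp_add)
      then show ?thesis using p by (simp add: powr_def)
    qed
    ultimately have "(1 - mu) * p powr (1 / (1 - mu)) * 2 powr (- eta) = p * (1 - mu) * r ^ Suc m"
      by (simp add: mult_ac)
    moreover have "p * b ^ Suc m = 1" using p by (simp add: b_pow P_def exp_minus del: power_Suc)
    moreover have "r \<le> b" "0 < r"
      using t P c by (auto simp: r_def b_def intro!: order_trans[of "- (t / c)" 0 "P / c"])
    ultimately show "\<exists>r b. 0 < r \<and> r \<le> b \<and> r * (1 - mu) + b * mu \<le> 1 - delta \<and>
        (1 - mu) * p powr (1 / (1 - mu)) * 2 powr (- eta) \<le> p * (1 - mu) * r ^ Suc m \<and>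
        1 \<le> p * b ^ Suc m"
      using sub by (metis order_refl)
  qed
qed

text \<open>The starting potential with \<open>X = Y = V\<close>. The 1 added to \<open>D\<close>
  accounts for the vertex itself, which is neither a red nor a blue neighbour.\<close>

lemma (in red_graph) potential_self_ge:
  assumes V: "finite V" "V \<noteq> {}" and s: "s \<ge> 0"
    and D: "\<And>v. v \<in> V \<Longrightarrow> real (card (blue V v)) \<le> D" "(D + 1) / card V \<le> 1 - p - s"
  shows "real (card V) * s ^ c \<le> potential p c V V"
proof -
  have cV: "card V > 0" using V by (simp add: card_gt_0_iff)
  have "s \<le> excess p V v" if v: "v \<in> V" for v
  proof -
    have "real (card V) - (D + 1) \<le> real (card (red V v))"
      using card_split_at[OF V(1) v] D(1)[OF v] by simp
    then have "(real (card V) - (D + 1)) / card V \<le> real (card (red V v)) / card V"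
      by (rule divide_right_mono) simp
    then have "p + s \<le> real (card (red V v)) / card V"
      using D(2) cV by (simp add: diff_divide_distrib)
    then show ?thesis by (simp add: excess_def)
  qed
  then have "(\<Sum>v\<in>V. s ^ c) \<le> (\<Sum>v\<in>V. excess p V v ^ c)"
    using s by (intro sum_mono power_mono) auto
  then show ?thesis by (simp add: potential_def)
qed

section \<open>The induction on the size of the blue clique\<close>

text \<open>The target bound with the linear error \<open>eta * k\<close> in place of
  \<open>g k\<close>.\<close>

definition ramsey_bound :: "real \<Rightarrow> nat \<Rightarrow> nat \<Rightarrow> real" where
  "ramsey_bound eta k l = 2 powr (eta * real k - 2/9 * real l) * real ((k + l) choose l)"

lemma ramsey_bound_pos: "ramsey_bound eta k l > 0"
  by (simp add: ramsey_bound_def)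

lemma ramsey_bound_ge:
  assumes "l \<le> k"
  shows "2 powr (eta * real k) \<le> ramsey_bound eta k l"
proof -
  have "2 powr (2/9 * real l) \<le> (2::real) powr real l" by (intro powr_mono) auto
  also have "\<dots> = 2 ^ l" by (simp add: powr_realpow)
  also have "\<dots> \<le> real ((k + l) choose l)"
  proof (cases "l = 0")
    case False
    have "2 ^ l \<le> (real (k + l) / real l) ^ l"
      using assms False by (intro power_mono) (auto simp: field_simps)
    also have "\<dots> \<le> real ((k + l) choose l)" by (rule binomial_ge_n_over_k_pow_k) simp
    finally show ?thesis .
  qed simp
  finally have "2 powr (eta * real k - 2/9 * real l) * 2 powr (2/9 * real l)
      \<le> 2 powr (eta * real k - 2/9 * real l) * real ((k + l) choose l)"
    by (intro mult_left_mono) auto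
  then show ?thesis by (simp add: ramsey_bound_def flip: powr_add)
qed

text \<open>This ratio bounds the blue density: without the desired cliques, a blue neighbourhood is
  smaller than the Ramsey number for \<open>l - 1\<close>.\<close>

lemma ramsey_bound_pred:
  assumes "l \<ge> 1"
  shows "ramsey_bound eta k (l - 1) = 2 powr (2/9) * (real l / real (k + l)) * ramsey_bound eta k l"
proof -
  obtain j where l: "l = Suc j" using assms by (cases l) auto
  have "real (Suc j) * real ((k + Suc j) choose Suc j) = real (k + Suc j) * real ((k + j) choose j)"
    using binomial_absorption[of j "k + Suc j"] by (metis of_nat_mult add_Suc_right diff_Suc_1)
  then have "real ((k + j) choose j) = real l / real (k + l) * real ((k + l) choose l)"
    by (simp add: l field_simps del: of_nat_Suc binomial_Suc_Suc)
  moreover have "2 powr (eta * real k - 2/9 * real j)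
      = 2 powr (2/9) * 2 powr (eta * real k - 2/9 * real l)"
    by (simp add: l algebra_simps add_divide_distrib flip: powr_add)
  ultimately show ?thesis by (simp add: ramsey_bound_def l del: binomial_Suc_Suc)
qed

lemma ln_choose_ge:
  assumes "k > 0" "l > 0" "mu = real l / real (k + l)"
  shows "- (real l * ln mu) - real k * ln (1 - mu) - ln (real (k + l + 1)) \<le> ln (real ((k + l) choose l))"
proof -
  have mu: "1 - mu = real k / real (k + l)" using assms by (simp add: field_simps)
  have "ln (real (k + l) ^ (k + l))
      \<le> ln (real (k + l + 1) * (real ((k + l) choose l) * real l ^ l * real k ^ k))"
    using assms by (intro ln_mono power_le_choose_times) auto
  also have "\<dots> = ln (real (k + l + 1)) + ln (real ((k + l) choose l)) + real l * ln (real l) + real k * ln (real k)"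
    using assms by (subst ln_mult ln_realpow; simp)+
  finally have bound: "real (k + l) * ln (real (k + l)) \<le>
      ln (real (k + l + 1)) + ln (real ((k + l) choose l)) + real l * ln (real l) + real k * ln (real k)"
    using assms by (simp add: ln_realpow)
  have "ln (real l) = ln mu + ln (real (k + l))"
    unfolding assms(3) using assms by (simp add: ln_div del: of_nat_add)
  moreover have "ln (real k) = ln (1 - mu) + ln (real (k + l))"
    unfolding mu using assms(1,2) by (simp add: ln_div del: of_nat_add)
  ultimately show ?thesis using bound by (simp add: algebra_simps)
qed

text \<open>This is the size requirement of \<open>clique_of_potential\<close> for
  \<open>L = l\<close> and \<open>y = 1 - x\<close>. The squared bound contributes
  \<open>2 * eta * k\<close> to the exponent of 2 and \<open>x ^ k\<close> takes back
  \<open>eta * k\<close>, leaving a surplus that beats constants and polynomials.\<close>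

lemma ramsey_bound_square_ge:
  fixes k l :: nat and eta :: real
  assumes k: "4 * l \<le> k" and l: "l > 0" and eta: "eta \<ge> 0" and mu: "mu = real l / real (k + l)"
    and x: "x = (1 - mu) * (1 - 7/6 * mu) powr (1 / (1 - mu)) * 2 powr (- eta)"
  shows "0 < x" "x < 1"
    "2 powr (eta * real k) / (real (k + l + 1))\<^sup>2
      \<le> x ^ k * mu ^ l * (1 - x) ^ l * (ramsey_bound eta k l)\<^sup>2"
proof -
  define n where "n = real (k + l)"
  define p where "p = 1 - 7/6 * mu"
  have k0: "k > 0" using k l by simp
  have n: "n > 0" "real l = n * mu" "real k = n * (1 - mu)"
    using k0 l by (auto simp: n_def mu field_simps)
  have mu_bds: "0 < mu" "mu \<le> 1/5" using k l by (auto simp: mu field_simps)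
  have p: "0 < p" using mu_bds by (simp add: p_def)
  show x0: "0 < x" unfolding x p_def[symmetric] using p mu_bds by simp
  have "x \<le> (1 - mu) * p powr (1 / (1 - mu)) * 1"
    unfolding x p_def[symmetric] using eta mu_bds powr_mono[of "- eta" 0 2]
    by (intro mult_left_mono) auto
  also have "\<dots> \<le> 1 - 1901/900 * mu" using red_ratio_le[OF mu_bds] by (simp add: p_def)
  finally have y: "1901/900 * mu \<le> 1 - x" by simp
  then show x1: "x < 1" using mu_bds by simp
  have ln_y: "ln (1901/900) + ln mu \<le> ln (1 - x)"
    using ln_mono[OF y] mu_bds ln_mult_pos[of "1901/900" mu] by simp
  have ln_x: "ln x = ln (1 - mu) + ln p / (1 - mu) - eta * ln 2"
    unfolding x p_def[symmetric] using mu_bds p by (simp add: ln_mult ln_powr)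
  \<comment> \<open>The exponent \<open>1 / (1 - mu)\<close> cancels against
    \<open>k = n * (1 - mu)\<close>.\<close>
  have "real k * (ln p / (1 - mu)) = n * ln p" using n(3) mu_bds by simp
  then have k_ln_x: "real k * ln x = real k * ln (1 - mu) + n * ln p - real k * (eta * ln 2)"
    by (simp add: ln_x algebra_simps)
  have ln_B: "ln (ramsey_bound eta k l)
      = (eta * real k - 2/9 * real l) * ln 2 + ln (real ((k + l) choose l))"
    unfolding ramsey_bound_def by (simp add: ln_mult ln_powr)
  have "n * ((1 - mu) * ln (1 - mu) + 4/9 * mu * ln 2) \<le> n * (ln p + mu * ln (1901/900))"
    unfolding p_def using entropy_inequality[OF mu_bds] n(1) by (intro mult_left_mono) auto
  then have entropy: "real k * ln (1 - mu) + 4/9 * real l * ln 2 \<le> n * ln p + real l * ln (1901/900)"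
    by (simp add: n(2,3) algebra_simps)
  have "real l * (ln (1901/900) + ln mu) \<le> real l * ln (1 - x)"
    by (rule mult_left_mono[OF ln_y]) simp
  \<comment> \<open>The terms in \<open>ln mu\<close> cancel, and what remains is \<open>n\<close>
    times the entropy inequality.\<close>
  then have "eta * real k * ln 2 - 2 * ln (real (k + l + 1))
      \<le> real k * ln x + real l * ln mu + real l * ln (1 - x) + 2 * ln (ramsey_bound eta k l)"
    using ln_choose_ge[OF k0 l mu] entropy unfolding k_ln_x ln_B by (simp add: algebra_simps)
  moreover have "ln (2 powr (eta * real k) / (real (k + l + 1))\<^sup>2)
      = eta * real k * ln 2 - 2 * ln (real (k + l + 1))"
    by (simp add: ln_div ln_powr ln_realpow)
  moreover have "ln (x ^ k * mu ^ l * (1 - x) ^ l * (ramsey_bound eta k l)\<^sup>2)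
      = real k * ln x + real l * ln mu + real l * ln (1 - x) + 2 * ln (ramsey_bound eta k l)"
    using x0 x1 mu_bds ramsey_bound_pos[of eta k l] by (simp add: ln_mult ln_realpow)
  moreover have "0 < x ^ k * mu ^ l * (1 - x) ^ l * (ramsey_bound eta k l)\<^sup>2"
    using x0 x1 mu_bds ramsey_bound_pos[of eta k l] by simp
  moreover have "0 < 2 powr (eta * real k) / (real (k + l + 1))\<^sup>2" by simp
  ultimately show "2 powr (eta * real k) / (real (k + l + 1))\<^sup>2
      \<le> x ^ k * mu ^ l * (1 - x) ^ l * (ramsey_bound eta k l)\<^sup>2"
    using ln_le_cancel_iff by metis
qed

text \<open>Ninth powers reduce the first claim to 4 < (7/6)^9, true by a narrow margin. The strict
  gap makes the initial excess positive.\<close>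

lemma two_powr_two_ninths: "2 powr (2/9) < (7/6 :: real)" "1 \<le> 2 powr (2/9 :: real)"
proof -
  have "(2 powr (2/9 :: real)) ^ 9 = 4"
    by (simp add: powr_powr flip: powr_realpow)
  then have "(2 powr (2/9 :: real)) ^ 9 < (7/6) ^ 9" by (simp add: field_simps)
  then show "2 powr (2/9) < (7/6 :: real)" by (rule power_less_imp_less_base) simp
  show "1 \<le> 2 powr (2/9 :: real)" by (rule ge_one_powr_ge_zero) auto
qed

text \<open>In a graph on \<open>N\<close> vertices without the cliques, \<open>prev\<close> bounds
  all blue degrees, so every vertex has excess at least \<open>s\<close> over \<open>p\<close>. The
  resulting potential then forces a clique.\<close>

lemma ramsey_number_le_ramsey_bound_step:
  fixes eta delta s :: real
  assumes kl: "4 * l \<le> k" "l > 0" and eta: "0 \<le> eta" and mu: "mu = real l / real (k + l)"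
    and m: "m \<ge> 1" and delta: "delta > 0"
    and params: "\<And>p mu. 1/2 \<le> p \<Longrightarrow> p < 1 \<Longrightarrow> 0 < mu \<Longrightarrow> mu \<le> 1/5 \<Longrightarrow>
      \<exists>r b. 0 < r \<and> r \<le> b \<and> r * (1 - mu) + b * mu \<le> 1 - delta \<and>
        (1 - mu) * p powr (1 / (1 - mu)) * 2 powr (- eta) \<le> p * (1 - mu) * r ^ Suc m \<and>
        1 \<le> p * b ^ Suc m"
    and s: "0 < s" "s \<le> 1" "2 * s \<le> (7/6 - 2 powr (2/9)) * mu"
    and large: "2 / s + 1 \<le> 2 powr (eta * real k)"
      "4 * (real (k + l + 1))\<^sup>2 \<le> delta * s ^ Suc m * 2 powr (eta * real k)"
    and prev: "real (ramsey_number k (l - 1)) \<le> ramsey_bound eta k (l - 1)"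
  shows "real (ramsey_number k l) \<le> ramsey_bound eta k l"
proof -
  define B where "B = ramsey_bound eta k l"
  define N where "N = nat \<lfloor>B\<rfloor>"
  define V where "V = {..<N}"
  define p where "p = 1 - 7/6 * mu"
  define x where "x = (1 - mu) * p powr (1 / (1 - mu)) * 2 powr (- eta)"
  have B: "2 / s + 1 \<le> B" using ramsey_bound_ge[of l k eta] kl large(1) by (simp add: B_def)
  moreover have "2 / s \<ge> 2" using s by (simp add: field_simps)
  ultimately have N: "real N \<le> B" "B \<le> real N + 1" "real N > 0" "2 / s \<le> real N" "B / 2 \<le> real N"
    unfolding N_def by linarith+
  have cV: "card V = N" "finite V" "V \<noteq> {}" using N(3) by (auto simp: V_def)
  have mu_bds: "0 < mu" "mu \<le> 1/5" using kl by (auto simp: mu field_simps)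
  have p: "1/2 \<le> p" "p < 1" using mu_bds by (auto simp: p_def)
  obtain r b where rb: "0 < r" "r \<le> b" "r * (1 - mu) + b * mu \<le> 1 - delta"
      "x \<le> p * (1 - mu) * r ^ Suc m" "1 \<le> p * b ^ Suc m"
    using params[OF p mu_bds] unfolding x_def by blast
  note x = ramsey_bound_square_ge[OF kl eta mu x_def[unfolded p_def]]
  have "ramsey_number k l \<le> N"
  proof (rule ramsey_number_leI, rule ccontr)
    fix E :: "nat \<Rightarrow> nat \<Rightarrow> bool"
    assume "red_graph E"
    then interpret red_graph E .
    assume "\<not> (has_clique E {..<N} k \<or> has_clique (\<lambda>u v. \<not> E u v) {..<N} l)"
    then have none: "\<not> red_clique V k" "\<not> blue_clique V l" by (auto simp: V_def)
    define D where "D = 2 powr (2/9) * mu * B"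
    have D: "real (card (blue V v)) \<le> D" if v: "v \<in> V" for v
    proof -
      have "\<not> red_clique (blue V v) k" using none(1) has_clique_mono[OF _ blue_subset] by blast
      moreover have "\<not> blue_clique (blue V v) (l - 1)"
        using none(2) blue_clique_extend[OF _ v subset_refl, of "l - 1"] kl by auto
      ultimately have "\<not> ramsey_number k (l - 1) \<le> card (blue V v)"
        using clique_if_ramsey_number_le[of "blue V v" k "l - 1"] cV by auto
      then have "real (card (blue V v)) \<le> real (ramsey_number k (l - 1))" by simp
      also have "\<dots> \<le> D" using prev ramsey_bound_pred[of l eta k] kl by (simp add: D_def B_def mu)
      finally show ?thesis .
    qed
    have "2 powr (2/9) * mu \<le> (7/6) * (1/5)"
      using mu_bds two_powr_two_ninths by (intro mult_mono) auto
    \<comment> \<open>The coefficient of \<open>B\<close> is at most 7/30, so rounding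
      \<open>B\<close> down to \<open>N\<close> costs less than 1.\<close>
    then have "D \<le> 2 powr (2/9) * mu * real N + 1"
      using mult_left_mono[OF N(2), of "2 powr (2/9) * mu"] mu_bds by (simp add: D_def distrib_left)
    then have "(D + 1) / real N \<le> (2 powr (2/9) * mu * real N + 2) / real N"
      using N(3) by (intro divide_right_mono) auto
    also have "\<dots> = 2 powr (2/9) * mu + 2 / real N" using N(3) by (simp add: field_simps)
    also have "2 / real N \<le> s" using N(3,4) s by (simp add: field_simps)
    also have "2 powr (2/9) * mu + s \<le> 1 - p - s" using s(3) by (simp add: p_def algebra_simps)
    finally have pot1: "real (card V) * s ^ Suc m \<le> potential p (Suc m) V V"
      using D s cV by (intro potential_self_ge) auto
    have pot: "s ^ Suc m * real N * real N \<le> potential p (Suc m) V V * real (card V)"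
      using mult_left_mono[OF pot1, of "real N"] cV(1) by (simp add: mult_ac)
    have "1 \<le> delta * s ^ Suc m / 4 * (2 powr (eta * real k) / (real (k + l + 1))\<^sup>2)"
      using large(2) by (simp add: field_simps)
    also have "\<dots> \<le> delta * s ^ Suc m / 4 * (x ^ k * mu ^ l * (1 - x) ^ l * B\<^sup>2)"
      using x(3) delta s unfolding B_def by (intro mult_left_mono) auto
    \<comment> \<open>The factor 4 in \<open>large\<close> pays for replacing \<open>B\<close> by
      \<open>B / 2 \<le> N\<close> twice.\<close>
    also have "\<dots> = delta * x ^ k * mu ^ l * (1 - x) ^ l * (s ^ Suc m * (B / 2) * (B / 2))"
      by (simp add: power2_eq_square)
    also have "\<dots> \<le> delta * x ^ k * mu ^ l * (1 - x) ^ l * (s ^ Suc m * real N * real N)"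
      using N(5) delta s x mu_bds ramsey_bound_pos[of eta k l]
      by (intro mult_left_mono mult_mono) (auto simp: B_def)
    also have "\<dots> \<le> delta * x ^ k * mu ^ l * (1 - x) ^ l * (potential p (Suc m) V V * real (card V))"
      using pot delta x mu_bds by (intro mult_left_mono) auto
    finally have "red_clique (V \<union> V) k \<or> blue_clique V l \<or> blue_clique V l"
      using p m mu_bds delta rb x cV by (intro clique_of_potential) auto
    then show False using none by simp
  qed
  then show ?thesis using N(1) by (simp add: B_def)
qed

text \<open>The constants \<open>m\<close>, \<open>delta\<close> and \<open>s\<close> depend only on
  \<open>eta\<close>, so one threshold for \<open>k\<close> serves all steps of the induction on
  \<open>l\<close>.\<close>

lemma eventually_ramsey_number_le:
  fixes eta :: real
  assumes eta: "0 < eta" "eta \<le> 1"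
  shows "\<forall>\<^sub>F k in sequentially. \<forall>l. 4 * l \<le> k \<longrightarrow> real (ramsey_number k l) \<le> ramsey_bound eta k l"
proof -
  obtain m delta where md: "m \<ge> 1" "delta > 0"
    and params: "\<And>p mu. 1/2 \<le> p \<Longrightarrow> p < 1 \<Longrightarrow> 0 < mu \<Longrightarrow> mu \<le> 1/5 \<Longrightarrow>
      \<exists>r b. 0 < r \<and> r \<le> b \<and> r * (1 - mu) + b * mu \<le> 1 - delta \<and>
        (1 - mu) * p powr (1 / (1 - mu)) * 2 powr (- eta) \<le> p * (1 - mu) * r ^ Suc m \<and>
        1 \<le> p * b ^ Suc m"
    using exists_book_parameters[OF eta] by blast
  define e where "e = 7/6 - 2 powr (2/9 :: real)"
  define s where "s = e * eta / 2"
  have e: "0 < e" "e \<le> 1" using two_powr_two_ninths by (auto simp: e_def)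
  have "e * eta \<le> 1 * 1" using e eta by (intro mult_mono) auto
  then have s: "0 < s" "s \<le> 1" using e eta by (auto simp: s_def)
  define K where "K = delta * s ^ Suc m"
  have K: "K > 0" using md s by (simp add: K_def)
  \<comment> \<open>Half the exponent is used so that this one limit, through its square, also
    dominates quadratic terms.\<close>
  have lim: "(\<lambda>k. real k / (2 powr (eta / 2)) ^ k) \<longlonglongrightarrow> 0"
    using eta powr_less_mono[of 0 "eta / 2" 2] by (intro lim_n_over_pown) simp
  have sq: "((2 powr (eta / 2)) ^ k)\<^sup>2 = 2 powr (eta * real k)" for k
    by (simp add: powr_powr powr_add[symmetric] power2_eq_square flip: powr_realpow)
  have "\<forall>\<^sub>F k in sequentially. 2 / s + 1 \<le> 2 powr (eta * real k)"
    using order_tendstoD(2)[OF lim zero_less_one] eventually_ge_at_top[of "nat \<lceil>2 / s + 1\<rceil>"]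
  proof eventually_elim
    case (elim k)
    define z where "z = (2 powr (eta / 2 :: real)) ^ k"
    have "1 \<le> z" using eta by (auto simp: z_def intro!: one_le_power ge_one_powr_ge_zero)
    then have "real k \<le> z * 1" using elim(1) by (simp add: z_def[symmetric] field_simps)
    also have "\<dots> \<le> z * z" using \<open>1 \<le> z\<close> by (intro mult_left_mono) auto
    also have "\<dots> = 2 powr (eta * real k)" using sq[of k] by (simp add: z_def power2_eq_square)
    finally show ?case using elim(2) by linarith
  qed
  moreover have "\<forall>\<^sub>F k in sequentially. 4 * (2 * real k + 1)\<^sup>2 \<le> K * 2 powr (eta * real k)"
  proof -
    have "(\<lambda>k. 36 * (real k / (2 powr (eta / 2)) ^ k)\<^sup>2) \<longlonglongrightarrow> 36 * 0\<^sup>2"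
      by (intro tendsto_intros lim)
    then have "\<forall>\<^sub>F k in sequentially. 36 * (real k / (2 powr (eta / 2)) ^ k)\<^sup>2 < K"
      using K by (intro order_tendstoD(2)) auto
    with eventually_ge_at_top[of 1] show ?thesis
    proof eventually_elim
      case (elim k)
      have "4 * (2 * real k + 1)\<^sup>2 \<le> 4 * (3 * real k)\<^sup>2"
        using elim(1) by (intro mult_left_mono power_mono) auto
      also have "\<dots> \<le> K * 2 powr (eta * real k)"
        using elim(2) by (simp add: power_divide sq pos_divide_less_eq power_mult_distrib)
      finally show ?case .
    qed
  qed
  ultimately show ?thesis
  proof eventually_elim
    case (elim k)
    show ?case
    proof (intro allI impI)
      fix l
      assume "4 * l \<le> k"
      then show "real (ramsey_number k l) \<le> ramsey_bound eta k l"
      proof (induction l)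
        case 0
        have "real (ramsey_number k 0) \<le> 1" using ramsey_number_le_choose[of k 0] by simp
        also have "\<dots> \<le> ramsey_bound eta k 0"
          using eta by (simp add: ramsey_bound_def ge_one_powr_ge_zero)
        finally show ?case .
      next
        case (Suc j)
        define l where "l = Suc j"
        show ?case
        \<comment> \<open>For small \<open>l\<close> the error term absorbs the whole saving and
          Erdos--Szekeres suffices. Otherwise \<open>mu \<ge> eta\<close>, which makes the gap
          proportional to \<open>mu\<close> at least \<open>2 * s\<close>.\<close>
        proof (cases "2/9 * real l \<le> eta * real k")
          case True
          have "real (ramsey_number k l) \<le> 1 * real ((k + l) choose l)"
            using ramsey_number_le_choose[of k l] by simp
          also have "\<dots> \<le> ramsey_bound eta k l"
            unfolding ramsey_bound_def using True
            by (intro mult_right_mono ge_one_powr_ge_zero) auto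
          finally show ?thesis by (simp add: l_def)
        next
          case False
          define mu where "mu = real l / real (k + l)"
          have l: "4 * l \<le> k" "l > 0" using Suc.prems by (auto simp: l_def)
          have "eta * real (k + l) \<le> eta * (2 * real k)" using l eta by (intro mult_left_mono) auto
          then have "eta \<le> mu" using False l by (simp add: mu_def pos_le_divide_eq)
          then have gap: "2 * s \<le> (7/6 - 2 powr (2/9)) * mu"
            using e by (simp add: s_def e_def[symmetric])
          have large: "4 * (real (k + l + 1))\<^sup>2 \<le> delta * s ^ Suc m * 2 powr (eta * real k)"
          proof -
            have "4 * (real (k + l + 1))\<^sup>2 \<le> 4 * (2 * real k + 1)\<^sup>2"
              using l by (intro mult_left_mono power_mono) auto
            also have "\<dots> \<le> K * 2 powr (eta * real k)" by (rule elim(2))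
            finally show ?thesis by (simp add: K_def)
          qed
          have prev: "real (ramsey_number k (l - 1)) \<le> ramsey_bound eta k (l - 1)"
            using Suc by (simp add: l_def)
          have "real (ramsey_number k l) \<le> ramsey_bound eta k l"
            by (rule ramsey_number_le_ramsey_bound_step[OF l less_imp_le[OF eta(1)] mu_def md params s gap
                  elim(1) large prev])
          then show ?thesis by (simp add: l_def)
        qed
      qed
    qed
  qed
qed

section \<open>From arbitrary linear errors to a single sublinear function\<close>

lemma ramsey_number_pos:
  assumes "k > 0" "l > 0"
  shows "ramsey_number k l > 0"
proof (rule ccontr)
  assume "\<not> ?thesis"
  then have "ramsey_number k l \<le> 0" by simp
  then have "(\<exists>R\<subseteq>{..<0::nat}. card R = k) \<or> (\<exists>B\<subseteq>{..<0::nat}. card B = l)"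
    unfolding ramsey_number_le_iff partn_lst_two_colours
    by (elim allE[of _ "\<lambda>_. 0"]) blast
  then show False using assms by auto
qed

theorem theorem4p4:
  shows "\<exists>g :: nat \<Rightarrow> real.
    (\<lambda>k. g k / real k) \<longlonglongrightarrow> 0 \<and>
    (\<forall>k l :: nat. k \<ge> 2 \<longrightarrow> l \<ge> 2 \<longrightarrow> real l \<le> real k / 4 \<longrightarrow>
      real (ramsey_number k l) \<le> 2 powr (- (2/9) * real l + g k) * real ((k + l) choose l))"
proof -
  \<comment> \<open>\<open>G k l\<close> is the exact error needed at \<open>l\<close>;
    \<open>g k\<close> is the largest one over admissible \<open>l\<close>. Inserting 0 keeps the
    maximum defined and nonnegative.\<close>
  define G where "G k l = log 2 (real (ramsey_number k l) / real ((k + l) choose l)) + 2/9 * real l" for k l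
  define g where "g k = Max (insert 0 (G k ` {l. 2 \<le> l \<and> 4 * l \<le> k}))" for k
  have fin: "finite (insert 0 (G k ` {l. 2 \<le> l \<and> 4 * l \<le> k}))" for k
    by (intro finite.insertI finite_imageI) (rule finite_subset[of _ "{..k}"], auto)
  have g0: "g k \<ge> 0" for k unfolding g_def using fin by (intro Max_ge) auto
  have "(\<lambda>k. g k / real k) \<longlonglongrightarrow> 0"
  proof (rule LIMSEQ_I)
    fix e :: real
    assume "e > 0"
    \<comment> \<open>The cap at 1 meets the hypothesis of the eventual bound, and halving
      \<open>e\<close> gives the strict inequality.\<close>
    define eta where "eta = min 1 (e / 2)"
    have eta: "0 < eta" "eta \<le> 1" "eta < e" using \<open>e > 0\<close> by (auto simp: eta_def)
    have "\<forall>\<^sub>F k in sequentially. norm (g k / real k - 0) < e"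
      using eventually_ramsey_number_le[OF eta(1,2)] eventually_gt_at_top[of 0]
    proof eventually_elim
      case (elim k)
      have "G k l \<le> eta * real k" if l: "2 \<le> l" "4 * l \<le> k" for l
      proof -
        have pos: "real (ramsey_number k l) > 0" using ramsey_number_pos[of k l] l by simp
        have "real (ramsey_number k l) / real ((k + l) choose l) \<le> 2 powr (eta * real k - 2/9 * real l)"
          using elim(1) l by (simp add: ramsey_bound_def pos_divide_le_eq)
        then have "log 2 (real (ramsey_number k l) / real ((k + l) choose l)) \<le> eta * real k - 2/9 * real l"
          using pos by (simp add: log_le_iff)
        then show ?thesis by (simp add: G_def)
      qed
      then have "g k \<le> eta * real k"
        unfolding g_def using eta by (subst Max_le_iff[OF fin]) auto
      then have "g k / real k \<le> eta" using elim(2) by (simp add: pos_divide_le_eq)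
      then show ?case using eta g0[of k] by simp
    qed
    then show "\<exists>k0. \<forall>k\<ge>k0. norm (g k / real k - 0) < e" by (simp add: eventually_sequentially)
  qed
  moreover have "real (ramsey_number k l) \<le> 2 powr (- (2/9) * real l + g k) * real ((k + l) choose l)"
    if "k \<ge> 2" "l \<ge> 2" "real l \<le> real k / 4" for k l
  proof -
    have pos: "real (ramsey_number k l) > 0" using ramsey_number_pos[of k l] that by simp
    have "G k l \<le> g k" unfolding g_def using that fin by (intro Max_ge) auto
    then have "log 2 (real (ramsey_number k l) / real ((k + l) choose l)) \<le> - (2/9) * real l + g k"
      by (simp add: G_def)
    then have "real (ramsey_number k l) / real ((k + l) choose l) \<le> 2 powr (- (2/9) * real l + g k)"
      using pos by (subst (asm) log_le_iff) auto
    then show ?thesis by (simp add: pos_divide_le_eq)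
  qed
  ultimately show ?thesis by (intro exI[of _ g]) simp
qed

end
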